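(* Let $A\in\mathbb{R}^{n\times n}$, and let $\mathcal{C_L}=\{x\in\mathbb{R}^n : x^TQx\le 0,\ x^TQu_n\le 0\}$ be a Lorenz cone, where $Q\in\mathbb{R}^{n\times n}$ is a symmetric matrix with inertia $\{n-1,0,1\}$ and $u_n$ is an eigenvector of $Q$ for its negative eigenvalue. Assume that $\mathcal{C_L}$ is an invariant set for the continuous system $\dot{x}(t)=Ax(t)$. Then there exists $\hat\tau>0$ such that for every $x_k\in\mathcal{C_L}$ and every $\Delta t\in[0,\hat\tau]$ we have $x_{k+1}\in\mathcal{C_L}$, where $x_{k+1}=(I-\Delta t A)^{-1}x_k$ is obtained by the backward Euler method; i.e., $\mathcal{C_L}$ is an invariant set for the discrete system $x_{k+1}=(I-\Delta t A)^{-1}x_k$ for every such $\Delta t$. Moreover, $\hat\tau$ can be taken to be any number in $[0,\bar\tau)$, where $\bar\tau=\sup\{\tau : I-A\Delta t \text{ is nonsingular for every } \Delta t\in[0,\tau]\}$.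
   Context: Inertia $\{n-1,0,1\}$ means that $Q$ has $n-1$ positive eigenvalues, no zero eigenvalue, and exactly one negative eigenvalue. A set $\mathcal{S}$ is an invariant set for $\dot x(t)=Ax(t)$ if $x(0)\in\mathcal{S}$ implies $x(t)\in\mathcal{S}$ for all $t\ge0$. It is an invariant set for a discrete system $x_{k+1}=Mx_k$ if $x_k\in\mathcal{S}$ implies $x_{k+1}\in\mathcal{S}$ for all $k\in\mathbb{N}$. A statement about $x_{k+1}=(I-\Delta t A)^{-1}x_k$ is understood to include that $I-\Delta t A$ is nonsingular. In the definition of $\bar\tau$, $\tau$ ranges over nonnegative reals, and $\bar\tau$ may be $+\infty$. *)

theory Defs
  imports "HOL-Analysis.Analysis" "HOL-Computational_Algebra.Polynomial"
begin

text \<open>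
  The characteristic polynomial \<open>det (X I - A)\<close>, as a determinant over the polynomial ring.
\<close>

definition charpoly :: "real^'n^'n \<Rightarrow> real poly" where
  "charpoly A = det (\<chi> i j. (if i = j then [:0, 1:] else 0) - [:A $ i $ j:])"

text \<open>
  The inertia of a symmetric matrix: the numbers of its positive, zero and negative
  eigenvalues, counted with algebraic multiplicity.  Only the real roots of the characteristic
  polynomial are counted; for a symmetric matrix these are all of its roots.
\<close>

definition inertia :: "real^'n^'n \<Rightarrow> nat \<times> nat \<times> nat" where
  "inertia Q =
     (size (filter_mset (\<lambda>l. l > 0) (proots (charpoly Q))),
      size (filter_mset (\<lambda>l. l = 0) (proots (charpoly Q))),
      size (filter_mset (\<lambda>l. l < 0) (proots (charpoly Q))))"

definition eigenvector :: "real^'n^'n \<Rightarrow> real^'n \<Rightarrow> real \<Rightarrow> bool" where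
  "eigenvector A v l \<longleftrightarrow> v \<noteq> 0 \<and> A *v v = l *\<^sub>R v"

definition lorenz_cone :: "real^'n^'n \<Rightarrow> real^'n \<Rightarrow> (real^'n) set" where
  "lorenz_cone Q u = {x. x \<bullet> (Q *v x) \<le> 0 \<and> x \<bullet> (Q *v u) \<le> 0}"

definition continuous_invariant :: "real^'n^'n \<Rightarrow> (real^'n) set \<Rightarrow> bool" where
  "continuous_invariant A S \<longleftrightarrow>
     (\<forall>x :: real \<Rightarrow> real^'n.
        (\<forall>t\<ge>0. (x has_vector_derivative A *v x t) (at t within {0..})) \<longrightarrow>
        x 0 \<in> S \<longrightarrow> (\<forall>t\<ge>0. x t \<in> S))"

definition discrete_invariant :: "real^'n^'n \<Rightarrow> (real^'n) set \<Rightarrow> bool" where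
  "discrete_invariant M S \<longleftrightarrow>
     (\<forall>x :: nat \<Rightarrow> real^'n.
        (\<forall>k. x (Suc k) = M *v x k) \<longrightarrow> (\<forall>k. x k \<in> S \<longrightarrow> x (Suc k) \<in> S))"

definition backward_euler_invariant :: "real^'n^'n \<Rightarrow> real \<Rightarrow> (real^'n) set \<Rightarrow> bool" where
  "backward_euler_invariant A h S \<longleftrightarrow>
     invertible (mat 1 - h *\<^sub>R A) \<and> discrete_invariant (matrix_inv (mat 1 - h *\<^sub>R A)) S"

text \<open>
  The bound on the step size is extended-real valued, since the supremum may be infinite.
\<close>

definition tau_bar :: "real^'n^'n \<Rightarrow> ereal" where
  "tau_bar A =
     Sup {ereal t |t. 0 \<le> t \<and> (\<forall>h\<in>{0..t}. invertible (mat 1 - h *\<^sub>R A))}"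

end

theory Submission
  imports Defs
begin

text \<open>
  The argument separates a fact about linear flows from one about Lorenz cones.

  The first is that a backward Euler step preserves every closed convex set \<open>S\<close> with nonempty
  interior that the flow of \<open>A\<close> preserves, as long as \<open>mat 1 - s *\<^sub>R A\<close> is nonsingular for all
  step sizes \<open>s\<close> from 0 up to the one used (\<open>resolvent_maps_convex_invariant_set\<close>).  A step of
  size \<open>s\<close> maps \<open>y\<close> to the point \<open>z\<close> with \<open>y = z - s *\<^sub>R (A *v z)\<close>.  If \<open>y\<close> is interior and \<open>z\<close>
  leaves \<open>S\<close> as \<open>s\<close> grows, then \<open>z\<close> lies on the frontier for some \<open>s\<close>.  There the vector field
  \<open>A *v z\<close> does not point out of \<open>S\<close> (\<open>supporting_functional_nonneg_on_field\<close>), so \<open>y\<close>, reached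
  from \<open>z\<close> by moving against the field, is on the wrong side of a supporting hyperplane: it
  cannot be interior.  Bounding the step size by the first singularity keeps the curve of
  points \<open>z\<close> continuous.

  The second is that the Lorenz cone is such a set.  Closedness is clear, and \<open>u\<close> is an interior
  point because both defining inequalities are strict there.  Convexity rests on the form of \<open>Q\<close>
  being positive semidefinite on the complement of \<open>u\<close> (\<open>psd_on_orthogonal_complement\<close>).
  Otherwise the minimizer of the form on the unit sphere of that complement would be an
  eigenvector for a negative eigenvalue and orthogonal to \<open>u\<close>, so the characteristic polynomial
  would have two negative roots, counted with multiplicity
  (\<open>two_eigenvalues_dvd_charpoly\<close>), against the inertia of \<open>Q\<close>.

  A positive step bound exists because small perturbations of the identity are nonsingular, and
  any \<open>tau\<close> below the supremum \<open>tau_bar A\<close> lies in an interval free of singular step sizes.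
\<close>

section \<open>Convex invariant sets under the backward Euler step\<close>

text \<open>
  The solution is the exponential series \<open>\<Sum>k. t^k / k! *\<^sub>R A^k x0\<close>, taken component by
  component so that differentiation is that of real power series.  Invariance is a statement
  about all solutions and says something about a point only because a solution starts there.
\<close>

lemma linear_ode_solution_exists:
  fixes A :: "real^'n^'n" and x0 :: "real^'n"
  obtains x :: "real \<Rightarrow> real^'n"
  where "x 0 = x0" and "\<And>t. (x has_vector_derivative A *v x t) (at t)"
proof -
  define c where "c = (\<lambda>k. ((\<lambda>y. A *v y) ^^ k) x0)"
  define x where "x = (\<lambda>t. \<chi> i. \<Sum>k. (c k $ i / fact k) * t ^ k)"
  obtain K where K: "K > 0" "\<And>y. norm (A *v y) \<le> norm y * K"
    using bounded_linear.pos_bounded[OF matrix_vector_mul_bounded_linear[of A]] by blast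
  have c_Suc: "c (Suc k) $ i = (\<Sum>j\<in>UNIV. A $ i $ j * c k $ j)" for k i
    by (simp add: c_def matrix_vector_mult_def)
  have norm_c: "norm (c k) \<le> norm x0 * K ^ k" for k
  proof (induction k)
    case (Suc k)
    have "norm (c (Suc k)) \<le> norm (c k) * K"
      using K(2) by (simp add: c_def)
    also have "\<dots> \<le> norm x0 * K ^ k * K"
      using Suc K(1) by (intro mult_right_mono) auto
    finally show ?case by (simp add: mult_ac)
  qed (simp add: c_def)
  have summ: "summable (\<lambda>k. (c k $ i / fact k) * t ^ k)" for i t
  proof (rule summable_comparison_test')
    show "summable (\<lambda>k. norm x0 * (inverse (fact k) * (K * \<bar>t\<bar>) ^ k))"
      by (intro summable_mult summable_exp)
    fix k :: nat
    assume "k \<ge> 0"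
    have "\<bar>c k $ i\<bar> \<le> norm x0 * K ^ k"
      using component_le_norm_cart[of "c k" i] norm_c[of k] by simp
    then have "\<bar>c k $ i\<bar> * (inverse (fact k) * \<bar>t\<bar> ^ k)
        \<le> norm x0 * K ^ k * (inverse (fact k) * \<bar>t\<bar> ^ k)"
      by (intro mult_right_mono) auto
    then show "norm (c k $ i / fact k * t ^ k)
        \<le> norm x0 * (inverse (fact k) * (K * \<bar>t\<bar>) ^ k)"
      by (simp add: abs_mult power_abs power_mult_distrib field_simps)
  qed
  have diffs_c: "diffs (\<lambda>k. c k $ i / fact k) = (\<lambda>k. c (Suc k) $ i / fact k)" for i
    by (simp add: diffs_def fun_eq_iff)
  have Ax: "(\<Sum>k. (c (Suc k) $ i / fact k) * t ^ k) = (A *v x t) $ i" for i t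
  proof -
    have "(\<Sum>k. (c (Suc k) $ i / fact k) * t ^ k)
        = (\<Sum>k. \<Sum>j\<in>UNIV. A $ i $ j * ((c k $ j / fact k) * t ^ k))"
      by (simp add: c_Suc sum_distrib_right sum_divide_distrib mult.assoc)
    also have "\<dots> = (\<Sum>j\<in>UNIV. A $ i $ j * (\<Sum>k. (c k $ j / fact k) * t ^ k))"
      by (subst suminf_sum) (simp_all only: summable_mult suminf_mult summ)
    finally show ?thesis
      by (simp add: x_def matrix_vector_mult_def)
  qed
  have component: "((\<lambda>s. x s $ i) has_real_derivative (A *v x t) $ i) (at t)" for i t
    using termdiffs_strong_converges_everywhere[OF summ, of i t]
    unfolding diffs_c Ax by (simp add: x_def)
  have "(x has_vector_derivative A *v x t) (at t)" for t
    unfolding has_vector_derivative_def has_derivative_componentwise_within[of x]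
    using component[of _ t]
    by (auto simp: Basis_vec_def inner_axis has_field_derivative_def mult_commute_abs)
  moreover have "x 0 = x0"
    unfolding x_def powser_zero by (simp add: c_def vec_eq_iff)
  ultimately show ?thesis
    using that by blast
qed

text \<open>
  The necessary half of Nagumo's tangency condition: along the trajectory from \<open>x\<close> the functional
  \<open>a\<close> never falls below its initial value, since the trajectory stays in \<open>S\<close>; hence its
  initial derivative \<open>a \<bullet> (A *v x)\<close> cannot be negative.
\<close>

lemma supporting_functional_nonneg_on_field:
  fixes A :: "real^'n^'n"
  assumes inv: "continuous_invariant A S" and "x \<in> S"
    and supp: "\<And>y. y \<in> S \<Longrightarrow> a \<bullet> x \<le> a \<bullet> y"
  shows "0 \<le> a \<bullet> (A *v x)"
proof (rule ccontr)
  assume "\<not> 0 \<le> a \<bullet> (A *v x)"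
  obtain z where z: "z 0 = x" "\<And>t. (z has_vector_derivative A *v z t) (at t)"
    using linear_ode_solution_exists by blast
  have z_in: "z t \<in> S" if "t \<ge> 0" for t
    using inv z \<open>x \<in> S\<close> that has_vector_derivative_at_within
    unfolding continuous_invariant_def by blast
  have "((\<lambda>t. a \<bullet> z t) has_vector_derivative a \<bullet> (A *v x)) (at 0)"
    using bounded_linear.has_vector_derivative[OF bounded_linear_inner_right z(2)[of 0]] z(1)
    by simp
  then have "((\<lambda>t. a \<bullet> z t) has_real_derivative a \<bullet> (A *v x)) (at 0)"
    by (simp add: has_real_derivative_iff_has_vector_derivative)
  from has_real_derivative_neg_dec_right[OF this]
  obtain d where "d > 0" "\<And>h. 0 < h \<Longrightarrow> h < d \<Longrightarrow> a \<bullet> z h < a \<bullet> x"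
    using \<open>\<not> 0 \<le> a \<bullet> (A *v x)\<close> z(1) by auto
  then show False
    using supp[OF z_in[of "d / 2"]] by (smt (verit) field_sum_of_halves)
qed

lemma matrix_mul_matrix_inv:
  fixes M :: "real^'n^'n"
  assumes "invertible M"
  shows "M ** matrix_inv M = mat 1"
  using assms someI_ex[of "\<lambda>N. M ** N = mat 1 \<and> N ** M = mat 1"]
  unfolding matrix_inv_def invertible_def by auto

text \<open>
  By Cramer's rule the components are quotients of determinants whose entries are affine in the
  step size.
\<close>

lemma continuous_on_resolvent:
  fixes A :: "real^'n^'n"
  assumes "\<And>h. h \<in> T \<Longrightarrow> invertible (mat 1 - h *\<^sub>R A)"
  shows "continuous_on T (\<lambda>h. matrix_inv (mat 1 - h *\<^sub>R A) *v y)"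
proof -
  define M where "M h = mat 1 - h *\<^sub>R A" for h
  have det_nz: "det (M h) \<noteq> 0" if "h \<in> T" for h
    using assms[OF that] by (simp add: M_def invertible_det_nz)
  have "continuous_on T (\<lambda>h. \<chi> k. det (\<chi> i j. if j = k then y $ i else M h $ i $ j) / det (M h))"
  proof (rule continuous_on_vec_lambda)
    fix k :: 'n
    have entry: "continuous_on T (\<lambda>h. M h $ i $ j)" for i j
      by (simp add: M_def) (intro continuous_intros)
    have "continuous_on T (\<lambda>h. if j = k then y $ i else M h $ i $ j)" for i j
      using entry by (cases "j = k") auto
    then show "continuous_on T
        (\<lambda>h. det (\<chi> i j. if j = k then y $ i else M h $ i $ j) / det (M h))"
      using det_nz entry
      by (intro continuous_on_divide) (simp_all add: det_def continuous_intros)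
  qed
  moreover have "matrix_inv (M h) *v y
      = (\<chi> k. det (\<chi> i j. if j = k then y $ i else M h $ i $ j) / det (M h))" if "h \<in> T" for h
  proof -
    have "M h *v (matrix_inv (M h) *v y) = y"
      using assms[OF that] matrix_mul_matrix_inv[of "M h"] by (simp add: M_def matrix_vector_mul_assoc)
    then show ?thesis
      using cramer[OF det_nz[OF that]] by simp
  qed
  ultimately show ?thesis
    unfolding M_def by (metis (no_types, lifting) continuous_on_cong)
qed

text \<open>
  Let \<open>R s\<close> be the inverse of \<open>mat 1 - s *\<^sub>R A\<close>.  Start at \<open>y\<close> in the interior and follow
  \<open>R s *v y\<close>, the result of a backward Euler step of size \<open>s\<close>, as \<open>s\<close> grows from 0.  If this curve left \<open>S\<close>, it would meet the frontier at some
  \<open>z = R s *v y\<close>, where \<open>y = z - s *\<^sub>R (A *v z)\<close>.  A functional \<open>a\<close> supporting \<open>S\<close> at \<open>z\<close>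
  satisfies \<open>a \<bullet> (A *v z) \<ge> 0\<close>, whence \<open>a \<bullet> y \<le> a \<bullet> z\<close>; but \<open>a\<close> is strictly larger at
  interior points than at \<open>z\<close>.  The points of \<open>S\<close> outside its interior are reached by density.
  The curve has to be followed from step size 0, so nonsingularity is required along the whole
  interval of step sizes up to \<open>h\<close>.
\<close>

theorem resolvent_maps_convex_invariant_set:
  fixes A :: "real^'n^'n"
  assumes "closed S" "convex S" "interior S \<noteq> {}"
    and inv: "continuous_invariant A S"
    and nonsing: "\<And>h. h \<in> {0..\<tau>} \<Longrightarrow> invertible (mat 1 - h *\<^sub>R A)"
    and h: "h \<in> {0..\<tau>}" and "x \<in> S"
  shows "matrix_inv (mat 1 - h *\<^sub>R A) *v x \<in> S"
proof -
  define R where "R s = matrix_inv (mat 1 - s *\<^sub>R A)" for s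
  have resolvent: "R s *v y - s *\<^sub>R (A *v (R s *v y)) = y" if "s \<in> {0..h}" for s y
  proof -
    have "(mat 1 - s *\<^sub>R A) *v (R s *v y) = y"
      using nonsing[of s] that h matrix_mul_matrix_inv[of "mat 1 - s *\<^sub>R A"]
      by (simp add: R_def matrix_vector_mul_assoc)
    then show ?thesis
      by (simp add: matrix_vector_mult_diff_rdistrib scaleR_matrix_vector_assoc)
  qed
  have interior: "R h *v y \<in> S" if y: "y \<in> interior S" for y
  proof (rule ccontr)
    assume "R h *v y \<notin> S"
    have "continuous_on {0..h} (\<lambda>s. R s *v y)"
      unfolding R_def using nonsing h by (intro continuous_on_resolvent) auto
    then have conn: "connected ((\<lambda>s. R s *v y) ` {0..h})"
      by (intro connected_continuous_image) auto
    have "R 0 *v y \<in> S"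
      using resolvent[of 0 y] h y interior_subset by auto
    moreover have "R 0 *v y \<in> (\<lambda>s. R s *v y) ` {0..h}"
      using h by (intro image_eqI[of _ _ 0]) auto
    ultimately have "(\<lambda>s. R s *v y) ` {0..h} \<inter> S \<noteq> {}"
      by blast
    moreover have "R h *v y \<in> (\<lambda>s. R s *v y) ` {0..h}"
      using h by auto
    then have "(\<lambda>s. R s *v y) ` {0..h} - S \<noteq> {}"
      using \<open>R h *v y \<notin> S\<close> by blast
    ultimately obtain s where s: "s \<in> {0..h}" and "R s *v y \<in> frontier S"
      using connected_Int_frontier[OF conn] by blast
    then have bd: "R s *v y \<in> S" "R s *v y \<notin> rel_interior S"
      using \<open>closed S\<close> rel_interior_nonempty_interior[OF \<open>interior S \<noteq> {}\<close>]
      by (auto simp: frontier_def)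
    obtain a where supp: "\<And>z. z \<in> S \<Longrightarrow> a \<bullet> (R s *v y) \<le> a \<bullet> z"
      and strict: "\<And>z. z \<in> rel_interior S \<Longrightarrow> a \<bullet> (R s *v y) < a \<bullet> z"
      using supporting_hyperplane_rel_boundary[OF \<open>convex S\<close> bd] by blast
    have "0 \<le> s * (a \<bullet> (A *v (R s *v y)))"
      using supporting_functional_nonneg_on_field[OF inv bd(1) supp] s by simp
    then have "a \<bullet> y \<le> a \<bullet> (R s *v y)"
      using arg_cong[OF resolvent[OF s, of y], of "inner a"] by (simp add: inner_diff_right)
    moreover have "a \<bullet> (R s *v y) < a \<bullet> y"
      using strict y rel_interior_nonempty_interior[OF \<open>interior S \<noteq> {}\<close>] by simp
    ultimately show False by simp
  qed
  have "x \<in> closure (interior S)"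
    using convex_closure_interior[OF \<open>convex S\<close> \<open>interior S \<noteq> {}\<close>] \<open>x \<in> S\<close> closure_subset by auto
  moreover have "(\<lambda>y. R h *v y) ` closure (interior S) \<subseteq> S"
    using interior \<open>closed S\<close>
    by (intro image_closure_subset) (auto intro: linear_continuous_on matrix_vector_mul_bounded_linear)
  ultimately show ?thesis
    by (auto simp: R_def)
qed

text \<open>
  When \<open>h\<close> times the operator norm of \<open>A\<close> is below 1, the map \<open>x \<mapsto> h *\<^sub>R (A *v x)\<close> fixes only 0.
\<close>

lemma ex_step_bound_nonsingular:
  fixes A :: "real^'n^'n"
  obtains \<tau> where "\<tau> > 0" "\<And>h. h \<in> {0..\<tau>} \<Longrightarrow> invertible (mat 1 - h *\<^sub>R A)"
proof -
  obtain K where K: "K > 0" "\<And>y. norm (A *v y) \<le> norm y * K"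
    using bounded_linear.pos_bounded[OF matrix_vector_mul_bounded_linear[of A]] by blast
  have "invertible (mat 1 - h *\<^sub>R A)" if h: "h \<in> {0..1 / (2 * K)}" for h
  proof -
    have "x = 0" if "(mat 1 - h *\<^sub>R A) *v x = 0" for x
    proof -
      have "x = h *\<^sub>R (A *v x)"
        using that by (simp add: matrix_vector_mult_diff_rdistrib scaleR_matrix_vector_assoc)
      then have "norm x = h * norm (A *v x)"
        using h by (metis abs_of_nonneg atLeastAtMost_iff norm_scaleR)
      also have "\<dots> \<le> 1 / (2 * K) * (norm x * K)"
        using h K by (intro mult_mono) auto
      finally show ?thesis
        using K(1) by simp
    qed
    then show ?thesis
      by (metis invertible_left_inverse matrix_left_invertible_ker)
  qed
  then show ?thesis
    using that[of "1 / (2 * K)"] K(1) by simp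
qed

section \<open>The quadratic form off its negative eigenvector\<close>

lemma ex_invertible_matrix_with_two_columns:
  fixes u v :: "real^'n"
  assumes "u \<noteq> 0" "v \<noteq> 0" "u \<bullet> v = 0"
  obtains P :: "real^'n^'n" and i j
  where "invertible P" "i \<noteq> j" "column i P = u" "column j P = v"
proof -
  have "u \<noteq> v"
    using assms by auto
  have "independent {u, v}"
    using assms by (intro pairwise_orthogonal_independent)
      (auto simp: pairwise_def orthogonal_def inner_commute)
  then obtain B where B: "{u, v} \<subseteq> B" "independent B" "UNIV \<subseteq> span B"
    using maximal_independent_subset_extend[of "{u, v}" UNIV] by auto
  have "finite B" "card B = CARD('n)"
    using B independent_bound basis_card_eq_dim[of B UNIV] by auto
  then obtain f where f: "bij_betw f (UNIV :: 'n set) B"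
    using finite_same_card_bij[of "UNIV :: 'n set" B] by auto
  define P :: "real^'n^'n" where "P = (\<chi> r c. f c $ r)"
  have col: "column k P = f k" for k
    by (simp add: P_def column_def vec_eq_iff)
  have "columns P = B"
    using f by (auto simp: columns_def col bij_betw_def)
  then have "\<exists>C. P ** C = mat 1"
    using B by (simp add: matrix_right_invertible_span_columns span_vec_eq top.extremum_unique)
  then have "invertible P"
    by (simp add: invertible_right_inverse)
  moreover obtain i j where "f i = u" "f j = v"
    using f B by (auto simp: bij_betw_def)
  ultimately show ?thesis
    using \<open>u \<noteq> v\<close> col by (intro that[of P i j]) auto
qed

lemma const_poly_sum: "(\<Sum>i\<in>I. [:f i:]) = [:\<Sum>i\<in>I. f i:]" for f :: "'b \<Rightarrow> real"
  by (induction I rule: infinite_finite_induct) auto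

text \<open>
  Multiply \<open>X I - Q\<close> on the right by an invertible constant matrix having \<open>u\<close> and \<open>v\<close> among its
  columns: these two columns become \<open>(X - l) u\<close> and \<open>(X - m) v\<close>, and both linear factors come out
  of the determinant.  Computing over the polynomial ring handles \<open>l = m\<close> together with
  \<open>l \<noteq> m\<close>, and so counts a repeated eigenvalue twice.
\<close>

lemma two_eigenvalues_dvd_charpoly:
  fixes Q :: "real^'n^'n"
  assumes u: "eigenvector Q u l" and v: "eigenvector Q v m" and "u \<bullet> v = 0"
  shows "[:-l, 1:] * [:-m, 1:] dvd charpoly Q"
proof -
  obtain P :: "real^'n^'n" and i j where "invertible P" and ij: "i \<noteq> j"
    and cols: "column i P = u" "column j P = v"
    using ex_invertible_matrix_with_two_columns u v \<open>u \<bullet> v = 0\<close>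
    unfolding eigenvector_def by metis
  then obtain P' where PP': "P ** P' = mat 1"
    unfolding invertible_def by blast
  define C :: "real^'n^'n \<Rightarrow> real poly^'n^'n" where "C M = (\<chi> r c. [:M $ r $ c:])" for M
  define X :: "real poly^'n^'n"
    where "X = (\<chi> i j. (if i = j then [:0, 1:] else 0) - [:Q $ i $ j:])"
  \<comment> \<open>Column \<open>k\<close> of \<open>X ** C P\<close> splits as the scalar \<open>c k\<close> times the vector \<open>g k\<close>.\<close>
  define c where "c k = (if k = i then [:-l, 1:] else if k = j then [:-m, 1:] else 1)" for k
  define g where "g k = (if k \<in> {i, j} then \<chi> r. [:P $ r $ k:] else column k (X ** C P))" for k
  \<comment> \<open>The determinant of the constant matrix is a unit of the polynomial ring, so it can be
    cancelled from the divisibility obtained below.\<close>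
  have "C P ** C P' = mat 1"
    using PP' by (auto simp: C_def matrix_matrix_mult_def mat_def vec_eq_iff const_poly_sum one_pCons
        mult.commute)
  then have det_C: "det (C P) * det (C P') = 1"
    by (metis det_I det_mul)
  have X_col: "column k (X ** C P) = [:-a, 1:] *s (\<chi> r. [:P $ r $ k:])"
    if "Q *v column k P = a *\<^sub>R column k P" for k a
  proof -
    have "(\<Sum>s\<in>UNIV. ((if r = s then [:0, 1:] else 0) - [:Q $ r $ s:]) * [:P $ s $ k:])
        = [:-a, 1:] * [:P $ r $ k:]" for r
    proof -
      have "(\<Sum>s\<in>UNIV. ((if r = s then [:0, 1:] else 0) - [:Q $ r $ s:]) * [:P $ s $ k:])
          = (\<Sum>s\<in>UNIV. (if r = s then [:0, 1:] * [:P $ s $ k:] else 0))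
            - (\<Sum>s\<in>UNIV. [:Q $ r $ s * P $ s $ k:])"
        unfolding sum_subtractf[symmetric] by (intro sum.cong) (auto simp: left_diff_distrib)
      also have "\<dots> = [:0, 1:] * [:P $ r $ k:] - [:(Q *v column k P) $ r:]"
        by (simp add: const_poly_sum matrix_vector_mult_def column_def)
      also have "\<dots> = [:-a, 1:] * [:P $ r $ k:]"
        using that by (simp add: column_def)
      finally show ?thesis .
    qed
    then show ?thesis
      by (simp add: column_def matrix_matrix_mult_def X_def C_def vec_eq_iff)
  qed
  have "transpose (X ** C P) = (\<chi> k. c k *s g k)"
  proof -
    have "column k (X ** C P) = c k *s g k" for k
      using u v X_col[of k] cols ij by (auto simp: c_def g_def eigenvector_def)
    then show ?thesis
      by (simp add: vec_eq_iff transpose_def column_def)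
  qed
  then have "det X * det (C P) = prod c UNIV * det (\<chi> k. g k)"
    using det_rows_mul[of c g] by (metis det_mul det_transpose)
  moreover have "prod c UNIV = prod c {i, j}"
    by (intro prod.mono_neutral_right) (auto simp: c_def)
  then have "prod c UNIV = [:-l, 1:] * [:-m, 1:]"
    using ij by (simp add: c_def)
  ultimately have "[:-l, 1:] * [:-m, 1:] dvd det X * det (C P)"
    by (metis dvd_triv_left)
  then have "[:-l, 1:] * [:-m, 1:] dvd det X * det (C P) * det (C P')"
    by (rule dvd_mult2)
  then show ?thesis
    using det_C by (simp add: charpoly_def X_def mult.assoc)
qed

lemma eigenvalue_nonneg_of_one_negative_inertia:
  fixes Q :: "real^'n^'n"
  assumes inertia: "inertia Q = (p, z, 1)"
    and "eigenvector Q u l" "eigenvector Q v m" "u \<bullet> v = 0" and neg: "l < 0"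
  shows "0 \<le> m"
proof (rule ccontr)
  assume "\<not> 0 \<le> m"
  let ?neg = "filter_mset (\<lambda>x. x < 0)"
  have one: "size (?neg (proots (charpoly Q))) = 1"
    using inertia by (simp add: inertia_def)
  then have "charpoly Q \<noteq> 0"
    by auto
  moreover obtain r where r: "charpoly Q = [:-l, 1:] * [:-m, 1:] * r"
    using two_eigenvalues_dvd_charpoly assms(2-4) by (metis dvdE)
  ultimately have "proots (charpoly Q) = {#l#} + {#m#} + proots r"
    by (simp only: proots_mult mult_eq_0_iff de_Morgan_disj proots_linear_factor minus_minus simp_thms)
  then show False
    using one neg \<open>\<not> 0 \<le> m\<close> by simp
qed

lemma symmetric_form_commute:
  fixes M :: "real^'n^'n"
  assumes "transpose M = M"
  shows "x \<bullet> (M *v y) = y \<bullet> (M *v x)"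
  using assms by (metis dot_lmul_matrix inner_commute transpose_matrix_vector)

text \<open>
  The degenerate case of the Cauchy-Schwarz inequality: if \<open>b = w \<bullet> (M *v v)\<close> were nonzero,
  the form at \<open>w + t *\<^sub>R v\<close> would be the nonconstant affine function \<open>q + 2 * t * b\<close> of \<open>t\<close>,
  which takes negative values.
\<close>

lemma psd_form_null_vector:
  fixes M :: "real^'n^'n"
  assumes sym: "transpose M = M" and W: "subspace W"
    and psd: "\<And>w. w \<in> W \<Longrightarrow> 0 \<le> w \<bullet> (M *v w)"
    and v: "v \<in> W" "v \<bullet> (M *v v) = 0" and w: "w \<in> W"
  shows "w \<bullet> (M *v v) = 0"
proof (rule ccontr)
  define b where "b = w \<bullet> (M *v v)"
  define q where "q = w \<bullet> (M *v w)"
  assume "w \<bullet> (M *v v) \<noteq> 0"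
  then have "b \<noteq> 0"
    by (simp add: b_def)
  have sym': "v \<bullet> (M *v w) = b"
    using symmetric_form_commute[OF sym] by (simp add: b_def)
  have quad: "0 \<le> q + 2 * t * b" for t
  proof -
    have "0 \<le> (w + t *\<^sub>R v) \<bullet> (M *v (w + t *\<^sub>R v))"
      using W v w by (intro psd) (auto simp: subspace_add subspace_scale)
    then show ?thesis
      using v sym' by (simp add: q_def b_def algebra_simps inner_simps matrix_vector_mult_scaleR
          matrix_vector_right_distrib)
  qed
  \<comment> \<open>The parameter at which the affine function takes the value \<open>-1\<close>.\<close>
  have "2 * (- (q + 1) / (2 * b)) * b = - (q + 1)"
    using \<open>b \<noteq> 0\<close> by (simp add: field_simps)
  then show False
    using quad[of "- (q + 1) / (2 * b)"] by linarith
qed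

lemma continuous_on_quadratic_form: "continuous_on S (\<lambda>x. x \<bullet> ((M :: real^'n^'n) *v x))"
  by (intro continuous_on_inner continuous_on_id matrix_vector_mult_linear_continuous_on)

text \<open>
  The minimum \<open>m\<close> of the form on the unit sphere of the complement of \<open>u\<close> is an eigenvalue, as in
  the variational proof of the spectral theorem: \<open>Q - m *\<^sub>R mat 1\<close> is positive semidefinite on the
  complement and vanishes at the minimizer \<open>v\<close> as a form.  As the complement is invariant under
  \<open>Q\<close>, the vector \<open>M *v v\<close> with \<open>M = Q - m *\<^sub>R mat 1\<close> lies in it and is therefore orthogonal to
  itself.  A negative \<open>m\<close> would be a second negative eigenvalue.
\<close>

lemma psd_on_orthogonal_complement:
  fixes Q :: "real^'n^'n"
  assumes sym: "transpose Q = Q" and inertia: "inertia Q = (p, z, 1)"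
    and "l < 0" and u: "eigenvector Q u l" and w: "w \<bullet> u = 0"
  shows "0 \<le> w \<bullet> (Q *v w)"
proof (cases "w = 0")
  case False
  define W where "W = {x. x \<bullet> u = 0}"
  have W: "subspace W"
    by (auto simp: W_def subspace_def inner_simps)
  note Q_sym = symmetric_form_commute[OF sym]
  have Q_W: "Q *v x \<in> W" if "x \<in> W" for x
    using that u Q_sym[of u x] by (simp add: W_def eigenvector_def inner_commute)
  let ?K = "W \<inter> sphere 0 1"
  have "compact ?K"
    using W by (intro closed_Int_compact closed_subspace) auto
  moreover have unit: "w /\<^sub>R norm w \<in> ?K"
    using w False by (simp add: W_def)
  ultimately obtain v where v: "v \<in> ?K" and min: "\<And>x. x \<in> ?K \<Longrightarrow> v \<bullet> (Q *v v) \<le> x \<bullet> (Q *v x)"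
    using continuous_attains_inf[OF _ _ continuous_on_quadratic_form, of ?K Q] by blast
  define m where "m = v \<bullet> (Q *v v)"
  define M where "M = Q - m *\<^sub>R mat 1"
  have M: "M *v x = Q *v x - m *\<^sub>R x" for x
    by (simp add: M_def matrix_vector_mult_diff_rdistrib flip: scaleR_matrix_vector_assoc)
  have vv: "v \<bullet> v = 1"
    using v by (simp add: dot_square_norm)
  have M_psd: "0 \<le> x \<bullet> (M *v x)" if "x \<in> W" for x
  proof (cases "x = 0")
    case False
    have "m \<le> (x /\<^sub>R norm x) \<bullet> (Q *v (x /\<^sub>R norm x))"
      unfolding m_def using that False W by (intro min) (auto simp: subspace_scale)
    also have "\<dots> = (x \<bullet> (Q *v x)) / (x \<bullet> x)"
      by (simp add: matrix_vector_mult_scaleR dot_square_norm power2_eq_square field_simps)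
    finally show ?thesis
      using False by (simp add: M inner_diff_right field_simps)
  qed simp
  have "transpose M = M"
    using sym by (simp add: M_def transpose_def vec_eq_iff mat_def)
  moreover have "M *v v \<in> W"
    using v Q_W W by (simp add: M subspace_diff subspace_scale)
  moreover have "v \<bullet> (M *v v) = 0"
    using vv by (simp add: M m_def inner_diff_right)
  ultimately have "(M *v v) \<bullet> (M *v v) = 0"
    using v psd_form_null_vector[OF _ W M_psd] by blast
  then have "M *v v = 0"
    unfolding inner_eq_zero_iff .
  then have "Q *v v = m *\<^sub>R v"
    by (simp add: M)
  then have "eigenvector Q v m"
    using vv by (auto simp: eigenvector_def)
  then have "0 \<le> m"
    using eigenvalue_nonneg_of_one_negative_inertia[OF inertia u] v \<open>l < 0\<close>
    by (simp add: W_def inner_commute)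
  moreover have "0 \<le> w \<bullet> (Q *v w) - m * (w \<bullet> w)"
    using M_psd[of w] w by (simp add: W_def M inner_diff_right)
  ultimately show ?thesis
    by (smt (verit) inner_ge_zero mult_nonneg_nonneg)
qed simp

section \<open>Geometry of the Lorenz cone\<close>

lemma closed_lorenz_cone: "closed (lorenz_cone Q u)"
proof -
  have "closed {x. x \<bullet> (Q *v x) \<le> 0}"
    by (rule closed_Collect_le[OF continuous_on_quadratic_form continuous_on_const])
  moreover have "closed {x. x \<bullet> (Q *v u) \<le> 0}"
    by (intro closed_Collect_le continuous_intros)
  ultimately show ?thesis
    by (simp add: lorenz_cone_def Collect_conj_eq closed_Int)
qed

text \<open>
  It is enough that \<open>x \<bullet> (Q *v y) \<le> 0\<close> for \<open>x\<close> and \<open>y\<close> in the cone, because a convex combination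
  then has a nonpositive form.  With \<open>a = x \<bullet> u\<close> and \<open>b = y \<bullet> u\<close>, the vector
  \<open>b *\<^sub>R x - a *\<^sub>R y\<close> is orthogonal to \<open>u\<close>; expanding its nonnegative form bounds \<open>2 * (a * b)\<close>
  times the cross term by a nonpositive number.  If \<open>a = 0\<close>, then \<open>x\<close> is a null vector of the
  semidefinite form on the complement of \<open>u\<close>, and the cross term is 0.
\<close>

lemma convex_lorenz_cone:
  fixes Q :: "real^'n^'n"
  assumes sym: "transpose Q = Q" and inertia: "inertia Q = (p, z, 1)"
    and "l < 0" and u: "eigenvector Q u l"
  shows "convex (lorenz_cone Q u)"
proof -
  define W where "W = {x. x \<bullet> u = 0}"
  have W: "subspace W"
    by (auto simp: W_def subspace_def inner_simps)
  have psd: "0 \<le> w \<bullet> (Q *v w)" if "w \<in> W" for w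
    using that psd_on_orthogonal_complement[OF assms] by (simp add: W_def)
  note Q_sym = symmetric_form_commute[OF sym]
  have Qu: "Q *v u = l *\<^sub>R u" and "u \<bullet> u > 0"
    using u by (auto simp: eigenvector_def)
  have cone: "x \<in> lorenz_cone Q u \<longleftrightarrow> x \<bullet> (Q *v x) \<le> 0 \<and> 0 \<le> x \<bullet> u" for x
    using \<open>l < 0\<close> by (simp add: lorenz_cone_def Qu mult_le_0_iff)
  have boundary: "x \<bullet> (Q *v y) = 0" if x: "x \<in> lorenz_cone Q u" and "x \<bullet> u = 0" for x y
  proof -
    have "x \<in> W"
      using that by (simp add: W_def)
    moreover have "x \<bullet> (Q *v x) = 0"
      using x cone psd[OF \<open>x \<in> W\<close>] by force
    moreover define b where "b = (y \<bullet> u) / (u \<bullet> u)"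
    have "y - b *\<^sub>R u \<in> W"
      using \<open>u \<bullet> u > 0\<close> by (simp add: W_def b_def inner_simps)
    ultimately have "(y - b *\<^sub>R u) \<bullet> (Q *v x) = 0"
      using psd_form_null_vector[OF sym W psd] by blast
    moreover have "u \<bullet> (Q *v x) = 0"
      using Q_sym[of u x] Qu \<open>x \<bullet> u = 0\<close> by simp
    ultimately show ?thesis
      by (simp add: Q_sym[of x y] inner_diff_left)
  qed
  have cross: "x \<bullet> (Q *v y) \<le> 0" if x: "x \<in> lorenz_cone Q u" and y: "y \<in> lorenz_cone Q u" for x y
  proof (cases "x \<bullet> u = 0 \<or> y \<bullet> u = 0")
    case True
    then show ?thesis
      using boundary[OF x] boundary[OF y] Q_sym[of x y] by auto
  next
    case False
    define a where "a = x \<bullet> u"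
    define b where "b = y \<bullet> u"
    have ab: "a > 0" "b > 0"
      using False x y cone unfolding a_def b_def by force+
    have "0 \<le> (b *\<^sub>R x - a *\<^sub>R y) \<bullet> (Q *v (b *\<^sub>R x - a *\<^sub>R y))"
      by (intro psd) (simp add: W_def a_def b_def inner_simps)
    also have "\<dots> = b\<^sup>2 * (x \<bullet> (Q *v x)) + a\<^sup>2 * (y \<bullet> (Q *v y)) - 2 * (a * b) * (x \<bullet> (Q *v y))"
      using Q_sym[of y x] by (simp add: inner_simps matrix_vector_mult_scaleR
          matrix_vector_mult_diff_distrib power2_eq_square algebra_simps)
    finally have "2 * (a * b) * (x \<bullet> (Q *v y)) \<le> b\<^sup>2 * (x \<bullet> (Q *v x)) + a\<^sup>2 * (y \<bullet> (Q *v y))"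
      by simp
    also have "\<dots> \<le> 0"
      using x y cone by (intro add_nonpos_nonpos mult_nonneg_nonpos) auto
    finally show ?thesis
      using ab by (simp add: mult_le_0_iff)
  qed
  show ?thesis
  proof (rule convexI)
    fix x y :: "real^'n" and a b :: real
    assume x: "x \<in> lorenz_cone Q u" and y: "y \<in> lorenz_cone Q u"
      and ab: "0 \<le> a" "0 \<le> b" "a + b = 1"
    have "(a *\<^sub>R x + b *\<^sub>R y) \<bullet> (Q *v (a *\<^sub>R x + b *\<^sub>R y))
        = a\<^sup>2 * (x \<bullet> (Q *v x)) + b\<^sup>2 * (y \<bullet> (Q *v y)) + 2 * (a * b) * (x \<bullet> (Q *v y))"
      using Q_sym[of y x] by (simp add: inner_simps matrix_vector_mult_scaleR
          matrix_vector_right_distrib power2_eq_square algebra_simps)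
    also have "\<dots> \<le> 0"
      using x y cone cross[OF x y] ab by (intro add_nonpos_nonpos mult_nonneg_nonpos) auto
    finally show "a *\<^sub>R x + b *\<^sub>R y \<in> lorenz_cone Q u"
      using x y ab by (simp add: cone inner_simps)
  qed
qed

lemma eigenvector_in_interior_lorenz_cone:
  fixes Q :: "real^'n^'n"
  assumes "l < 0" and u: "eigenvector Q u l"
  shows "u \<in> interior (lorenz_cone Q u)"
proof (rule interiorI)
  let ?U = "{x. x \<bullet> (Q *v x) < 0} \<inter> {x. x \<bullet> (Q *v u) < 0}"
  have "open {x. x \<bullet> (Q *v x) < 0}"
    by (rule open_Collect_less[OF continuous_on_quadratic_form continuous_on_const])
  moreover have "open {x. x \<bullet> (Q *v u) < 0}"
    by (intro open_Collect_less continuous_intros)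
  ultimately show "open ?U"
    by (rule open_Int)
  show "u \<in> ?U"
    using assms by (auto simp: eigenvector_def mult_less_0_iff)
  show "?U \<subseteq> lorenz_cone Q u"
    by (auto simp: lorenz_cone_def)
qed

section \<open>Invariance of Lorenz cones\<close>

theorem corollary4p18:
  fixes A Q :: "real^'n^'n" and u :: "real^'n" and l :: real
  assumes "transpose Q = Q"
    and "inertia Q = (CARD('n) - 1, 0, 1)"
    and "l < 0" and "eigenvector Q u l"
    and "continuous_invariant A (lorenz_cone Q u)"
  shows "(\<exists>tau>0. \<forall>h\<in>{0..tau}.
            backward_euler_invariant A h (lorenz_cone Q u) \<and>
            (\<forall>x\<in>lorenz_cone Q u. matrix_inv (mat 1 - h *\<^sub>R A) *v x \<in> lorenz_cone Q u)) \<and>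
         (\<forall>tau. 0 \<le> tau \<and> ereal tau < tau_bar A \<longrightarrow>
            (\<forall>h\<in>{0..tau}.
               backward_euler_invariant A h (lorenz_cone Q u) \<and>
               (\<forall>x\<in>lorenz_cone Q u. matrix_inv (mat 1 - h *\<^sub>R A) *v x \<in> lorenz_cone Q u)))"
proof -
  let ?C = "lorenz_cone Q u"
  have step: "backward_euler_invariant A h ?C \<and>
      (\<forall>x\<in>?C. matrix_inv (mat 1 - h *\<^sub>R A) *v x \<in> ?C)"
    if nonsing: "\<And>s. s \<in> {0..\<tau>} \<Longrightarrow> invertible (mat 1 - s *\<^sub>R A)" and h: "h \<in> {0..\<tau>}" for \<tau> h
  proof -
    have "interior ?C \<noteq> {}"
      using eigenvector_in_interior_lorenz_cone[OF assms(3,4)] by blast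
    then have maps: "\<forall>x\<in>?C. matrix_inv (mat 1 - h *\<^sub>R A) *v x \<in> ?C"
      using resolvent_maps_convex_invariant_set[OF closed_lorenz_cone
          convex_lorenz_cone[OF assms(1-4)] _ assms(5) nonsing h] by blast
    then show ?thesis
      using nonsing[OF h] by (simp add: backward_euler_invariant_def discrete_invariant_def)
  qed
  obtain \<tau>0 where "\<tau>0 > 0" "\<And>h. h \<in> {0..\<tau>0} \<Longrightarrow> invertible (mat 1 - h *\<^sub>R A)"
    using ex_step_bound_nonsingular by blast
  then have small: "\<exists>tau>0. \<forall>h\<in>{0..tau}. backward_euler_invariant A h ?C \<and>
      (\<forall>x\<in>?C. matrix_inv (mat 1 - h *\<^sub>R A) *v x \<in> ?C)"
    using step by blast
  have "backward_euler_invariant A h ?C \<and>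
      (\<forall>x\<in>?C. matrix_inv (mat 1 - h *\<^sub>R A) *v x \<in> ?C)"
    if tau: "ereal tau < tau_bar A" and h: "h \<in> {0..tau}" for tau h
  proof -
    obtain t where "tau < t" "\<forall>s\<in>{0..t}. invertible (mat 1 - s *\<^sub>R A)"
      using tau unfolding tau_bar_def less_Sup_iff by auto
    then show ?thesis
      using step[of t h] h by simp
  qed
  with small show ?thesis
    by blast
qed

end
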